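(* Let $p\ge 5$ be a prime number, let $\lambda,\mu\in\mathbb{F}_p$ with $\lambda\mu\neq 0$, and for a sequence $S=x_1x_2\cdots x_m$ in $\mathbb{F}_p$ let $$\varphi(S)=\Big(\sum_{i=1}^m x_i\Big)^2+\lambda\sum_{i=1}^m x_i^2+\mu\sum_{i=1}^m x_i .$$ Let $s$ be a positive integer. If $\left(\frac{i}{p}\right)=1$ for all $i\in\{1,\dots,s\}$, then $2p-1\ge D(\varphi,p)\ge p+s$.
   Context: $\mathbb{F}_p$ is the field with $p$ elements and $\left(\frac{\cdot}{p}\right)$ is the Legendre symbol. A sequence in $\mathbb{F}_p$ is a finite list of elements with repetition allowed, where the order is irrelevant (i.e. a finite multiset); its length is its number of terms counted with multiplicity, and a subsequence is a sub-multiset. A sequence $S$ is a $\varphi$-zero sequence if $\varphi(S)=0$ in $\mathbb{F}_p$. $D(\varphi,p)$ is the smallest positive integer $\ell$ such that every sequence in $\mathbb{F}_p$ of length at least $\ell$ has a nonempty $\varphi$-zero subsequence. *)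

theory Defs
  imports "HOL-Number_Theory.Number_Theory" "HOL-Library.Extended_Nat" "HOL-Library.Cardinality"
begin

definition quad_phi :: "'a::field \<Rightarrow> 'a \<Rightarrow> 'a multiset \<Rightarrow> 'a" where
  "quad_phi lam mu S = (\<Sum>x\<in>#S. x)\<^sup>2 + lam * (\<Sum>x\<in>#S. x\<^sup>2) + mu * (\<Sum>x\<in>#S. x)"

definition zero_sequence :: "('a multiset \<Rightarrow> 'a::field) \<Rightarrow> 'a multiset \<Rightarrow> bool" where
  "zero_sequence \<phi> S \<longleftrightarrow> \<phi> S = 0"

(* The minimum is taken in enat, so that it is infinite if no such length exists;
   a finite upper bound thus includes the existence of the minimum.
   The prime p is the cardinality of the type 'a. *)
definition davenport :: "('a multiset \<Rightarrow> 'a::field) \<Rightarrow> enat" where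
  "davenport \<phi> = Inf {enat l | l. 0 < l \<and>
     (\<forall>S :: 'a multiset. l \<le> size S \<longrightarrow>
        (\<exists>T. T \<subseteq># S \<and> T \<noteq> {#} \<and> zero_sequence \<phi> T))}"

end

theory Submission imports Defs begin

text \<open>
  Upper bound: a nonempty subsequence on which both \<open>\<Sum>x\<close> and \<open>\<Sum>x\<^sup>2\<close> vanish is a zero
  sequence. Among \<open>2p - 1\<close> terms one exists, as in the proof of Chevalley's theorem: for linear
  forms \<open>L\<close>, \<open>M\<close> in the indicator of the index set \<open>I\<close>, the function
  \<open>(1 - L\<^bsup>p-1\<^esup>) (1 - M\<^bsup>p-1\<^esup>)\<close> has degree \<open>2p - 2\<close>, so its alternating sum over all \<open>I\<close> vanishes,
  whereas it would be \<open>1\<close> if the empty set were the only common zero.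

  Lower bound: take \<open>p - 1\<close> copies of \<open>x = -\<mu>/\<lambda>\<close>, which satisfies \<open>\<lambda>x\<^sup>2 + \<mu>x = 0\<close>, and \<open>s\<close> copies of
  some \<open>y\<close> for which \<open>g = \<lambda>y\<^sup>2 + \<mu>y\<close> has the property that \<open>-g\<close> is not a square. On \<open>k\<close> copies of \<open>x\<close> and \<open>j\<close> copies
  of \<open>y\<close> the form takes the value \<open>w\<^sup>2 + j g\<close> with \<open>w = k x + j y\<close>. For \<open>j = 0\<close> this is nonzero since
  \<open>0 < k < p\<close>, and for \<open>j > 0\<close> since \<open>j\<close> is a nonzero square.
\<close>

section \<open>Degree of functions on finite sets\<close>

text \<open>Up to sign the sum is the iterated finite difference of \<open>F\<close> at
  \<open>B\<close> in the directions in \<open>A\<close>. It vanishes whenever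
  \<open>card A > d\<close> exactly if \<open>F\<close>, written as a multilinear polynomial in the
  indicators, has degree at most \<open>d\<close>. The base point \<open>B\<close> is kept general
  for the product rule below.\<close>

definition set_degree_le :: "('i set \<Rightarrow> 'r::comm_ring_1) \<Rightarrow> nat \<Rightarrow> bool" where
  "set_degree_le F d \<longleftrightarrow> (\<forall>A B. finite A \<longrightarrow> finite B \<longrightarrow> A \<inter> B = {} \<longrightarrow> d < card A \<longrightarrow>
     (\<Sum>I\<in>Pow A. (-1) ^ card I * F (I \<union> B)) = 0)"

lemma sum_Pow_insert:
  fixes f :: "'i set \<Rightarrow> 'r::comm_monoid_add"
  assumes "finite A" "a \<notin> A"
  shows "sum f (Pow (insert a A)) = sum f (Pow A) + (\<Sum>I\<in>Pow A. f (insert a I))"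
proof -
  have "inj_on (insert a) (Pow A)"
    using assms(2) by (auto simp: inj_on_def)
  moreover have "Pow A \<inter> insert a ` Pow A = {}"
    using assms(2) by auto
  ultimately show ?thesis
    using assms(1) by (simp add: Pow_insert sum.union_disjoint sum.reindex)
qed

lemma set_degree_le_mono:
  assumes "set_degree_le F d" "d \<le> e"
  shows "set_degree_le F e"
  using assms unfolding set_degree_le_def by (meson order.strict_trans1)

lemma set_degree_le_const:
  "set_degree_le (\<lambda>I. c) 0"
  unfolding set_degree_le_def
proof (intro allI impI)
  fix A B :: "'a set"
  assume A: "finite A" and "0 < card A"
  then obtain a where "a \<in> A" by fastforce
  then obtain A' where A': "A = insert a A'" "a \<notin> A'" by (meson mk_disjoint_insert)
  have "card (insert a I) = Suc (card I)" if "I \<in> Pow A'" for I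
    using that A A' by (metis PowD card_insert_disjoint finite_insert infinite_super subsetD)
  then show "(\<Sum>I\<in>Pow A. (-1) ^ card I * c) = 0"
    using A A' by (simp add: sum_Pow_insert sum_negf)
qed

lemma set_degree_le_diff:
  assumes "set_degree_le F d" "set_degree_le G d"
  shows "set_degree_le (\<lambda>I. F I - G I) d"
  using assms unfolding set_degree_le_def by (simp add: right_diff_distrib sum_subtractf)

text \<open>By linearity, only the indicator of a single \<open>i\<close> has to be considered. For
  \<open>i\<close> in \<open>B\<close> it is constantly 1. For \<open>i\<close> in \<open>A\<close>
  only the sets containing \<open>i\<close> survive, so \<open>i\<close> moves from \<open>A\<close>
  to \<open>B\<close>; the element lost from \<open>A\<close> is the extra degree.\<close>

lemma set_degree_le_mult_linear:
  assumes F: "set_degree_le F d"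
  shows "set_degree_le (\<lambda>I. sum x I * F I) (Suc d)"
  unfolding set_degree_le_def
proof (intro allI impI)
  fix A B :: "'a set"
  assume fin: "finite A" "finite B" and disj: "A \<inter> B = {}" and d: "Suc d < card A"
  let ?g = "\<lambda>I. (-1) ^ card I * F (I \<union> B)"
  have inner: "(\<Sum>I\<in>Pow A. if i \<in> I \<union> B then ?g I else 0) = 0" if "i \<in> A \<union> B" for i
  proof (cases "i \<in> B")
    case True
    then show ?thesis
      using F fin disj d unfolding set_degree_le_def by simp
  next
    case False
    with that obtain A' where A': "A = insert i A'" "i \<notin> A'"
      by (meson UnE mk_disjoint_insert)
    have card: "card (insert i I) = Suc (card I)" and ni: "i \<notin> I" if "I \<in> Pow A'" for I
      using that fin A' by (auto simp: card_insert_if finite_subset)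
    have "(\<Sum>I\<in>Pow A. if i \<in> I \<union> B then ?g I else 0) = (\<Sum>I\<in>Pow A'. ?g (insert i I))"
      using fin A' False ni by (simp add: sum_Pow_insert sum.neutral)
    also have "\<dots> = - (\<Sum>I\<in>Pow A'. (-1) ^ card I * F (I \<union> insert i B))"
      by (simp add: card sum_negf)
    also have "(\<Sum>I\<in>Pow A'. (-1) ^ card I * F (I \<union> insert i B)) = 0"
    proof -
      have "d < card A'" "finite A'" "finite (insert i B)" "A' \<inter> insert i B = {}"
        using fin d disj A' by auto
      then show ?thesis
        using F unfolding set_degree_le_def by blast
    qed
    finally show ?thesis by simp
  qed
  have "(\<Sum>I\<in>Pow A. (-1) ^ card I * (sum x (I \<union> B) * F (I \<union> B)))
      = (\<Sum>I\<in>Pow A. \<Sum>i\<in>A \<union> B. x i * (if i \<in> I \<union> B then ?g I else 0))"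
  proof (rule sum.cong[OF refl])
    fix I assume "I \<in> Pow A"
    then have "(A \<union> B) \<inter> (I \<union> B) = I \<union> B" by auto
    then have "sum x (I \<union> B) = (\<Sum>i\<in>A \<union> B. if i \<in> I \<union> B then x i else 0)"
      using fin sum.inter_restrict[of "A \<union> B" x "I \<union> B"] by simp
    then have "(-1) ^ card I * (sum x (I \<union> B) * F (I \<union> B))
        = (\<Sum>i\<in>A \<union> B. if i \<in> I \<union> B then x i else 0) * ?g I"
      by (simp add: ac_simps)
    also have "\<dots> = (\<Sum>i\<in>A \<union> B. x i * (if i \<in> I \<union> B then ?g I else 0))"
      unfolding sum_distrib_right by (rule sum.cong) auto
    finally show "(-1) ^ card I * (sum x (I \<union> B) * F (I \<union> B))
        = (\<Sum>i\<in>A \<union> B. x i * (if i \<in> I \<union> B then ?g I else 0))" .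
  qed
  also have "\<dots> = (\<Sum>i\<in>A \<union> B. x i * (\<Sum>I\<in>Pow A. if i \<in> I \<union> B then ?g I else 0))"
    by (subst sum.swap) (simp only: sum_distrib_left)
  also have "\<dots> = 0"
    using inner by (intro sum.neutral ballI) (simp only: mult_zero_right)
  finally show "(\<Sum>I\<in>Pow A. (-1) ^ card I * (sum x (I \<union> B) * F (I \<union> B))) = 0" .
qed

lemma set_degree_le_power_linear_mult:
  assumes "set_degree_le F d"
  shows "set_degree_le (\<lambda>I. sum x I ^ k * F I) (d + k)"
proof (induction k)
  case (Suc k)
  from set_degree_le_mult_linear[OF this, of x] show ?case by (simp add: mult.assoc)
qed (use assms in simp)

section \<open>Zero-sum subsequences\<close>

text \<open>Multiplication by \<open>x\<close> permutes the nonzero elements, hence preserves their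
  product.\<close>

lemma finite_field_power_card_minus_1:
  fixes x :: "'a::{field, finite}"
  assumes "x \<noteq> 0"
  shows "x ^ (CARD('a) - 1) = 1"
proof -
  let ?U = "UNIV - {0 :: 'a}"
  have "bij_betw ((*) x) ?U ?U"
    using assms by (intro bij_betwI[where g = "\<lambda>y. y / x"]) auto
  then have "(\<Prod>y\<in>?U. x * y) = \<Prod>?U"
    by (rule prod.reindex_bij_betw)
  then have "x ^ card ?U * \<Prod>?U = \<Prod>?U"
    by (simp only: prod.distrib prod_constant)
  moreover have "\<Prod>?U \<noteq> 0"
    by simp
  ultimately show ?thesis
    by (simp add: card_Diff_singleton)
qed

lemma two_zero_sums:
  fixes x y :: "'i \<Rightarrow> 'a::{field, finite}"
  assumes "finite A" "2 * CARD('a) - 1 \<le> card A"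
  obtains I where "I \<subseteq> A" "I \<noteq> {}" "sum x I = 0" "sum y I = 0"
proof (rule ccontr)
  assume "\<not> thesis"
  with that have no: "sum x I \<noteq> 0 \<or> sum y I \<noteq> 0" if "I \<subseteq> A" "I \<noteq> {}" for I
    using that by blast
  define q where "q = CARD('a) - 1"
  \<comment> \<open>Positivity of \<open>q\<close> ensures \<open>0 ^ q = 0\<close>, which gives
    \<open>F {} = 1\<close> at the end.\<close>
  have "card {0 :: 'a, 1} \<le> CARD('a)"
    by (rule card_mono) auto
  then have q: "q > 0" "2 * CARD('a) - 1 = q + q + 1"
    by (auto simp: q_def)
  define G where "G I = 1 - sum y I ^ q" for I
  define F where "F I = G I - sum x I ^ q * G I" for I
  have "set_degree_le (\<lambda>I. 1 :: 'a) q"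
    using set_degree_le_const set_degree_le_mono by blast
  moreover have "set_degree_le (\<lambda>I. sum y I ^ q) q"
    using set_degree_le_power_linear_mult[OF set_degree_le_const, of y q 1] by simp
  ultimately have G: "set_degree_le G q"
    unfolding G_def by (rule set_degree_le_diff)
  have "set_degree_le F (q + q)"
    unfolding F_def
    by (intro set_degree_le_diff set_degree_le_power_linear_mult G set_degree_le_mono[OF G]) simp
  then have zero: "(\<Sum>I\<in>Pow A. (-1) ^ card I * F I) = 0"
    using assms q unfolding set_degree_le_def
    by (elim allE[of _ A] allE[of _ "{}"]) simp
  have F0: "F I = 0" if "I \<in> Pow A - {{}}" for I
    using no[of I] that finite_field_power_card_minus_1[of "sum x I"]
      finite_field_power_card_minus_1[of "sum y I"]
    by (auto simp: F_def G_def q_def)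
  have "(\<Sum>I\<in>Pow A. (-1) ^ card I * F I)
      = F {} + (\<Sum>I\<in>Pow A - {{}}. (-1) ^ card I * F I)"
    using assms(1) by (subst sum.remove[of _ "{}"]) auto
  also have "\<dots> = 1"
    using q by (simp add: F0) (simp add: F_def G_def zero_power)
  finally show False
    using zero by simp
qed

text \<open>Positions in a list serve as indices, so that equal terms stay distinguishable.\<close>

lemma two_zero_sums_mset:
  fixes f g :: "'b \<Rightarrow> 'a::{field, finite}"
  assumes "2 * CARD('a) - 1 \<le> size S"
  obtains T where "T \<subseteq># S" "T \<noteq> {#}" "(\<Sum>x\<in>#T. f x) = 0" "(\<Sum>x\<in>#T. g x) = 0"
proof -
  obtain xs where xs: "S = mset xs" by (metis ex_mset)
  obtain I where I: "I \<subseteq> {..<length xs}" "I \<noteq> {}"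
      "(\<Sum>i\<in>I. f (xs ! i)) = 0" "(\<Sum>i\<in>I. g (xs ! i)) = 0"
    using two_zero_sums[of "{..<length xs}" "\<lambda>i. f (xs ! i)" "\<lambda>i. g (xs ! i)"] assms xs by auto
  define T where "T = image_mset ((!) xs) (mset_set I)"
  have fin: "finite I"
    using I(1) finite_subset by blast
  have "S = image_mset ((!) xs) (mset_set {..<length xs})"
    by (metis atLeast_upt map_nth mset_map mset_upt xs atLeast0LessThan)
  then have "T \<subseteq># S"
    unfolding T_def using I(1) by (simp add: image_mset_subseteq_mono subset_imp_msubset_mset_set)
  moreover have "T \<noteq> {#}"
    using I(2) fin by (simp add: T_def mset_set_empty_iff)
  moreover have "(\<Sum>x\<in>#T. f x) = 0" "(\<Sum>x\<in>#T. g x) = 0"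
    using I(3,4) by (simp_all add: T_def image_mset.compositionality comp_def sum_unfold_sum_mset)
  ultimately show thesis
    using that by blast
qed

section \<open>Squares\<close>

lemma CHAR_eq_prime_CARD:
  assumes "prime CARD('a::{field, finite})"
  shows "CHAR('a) = CARD('a)"
  using CHAR_dvd_CARD[where 'a = 'a] assms CHAR_not_1'[where 'a = 'a]
  by (metis One_nat_def prime_nat_iff)

lemma of_nat_square_of_Legendre:
  assumes "Legendre (int i) (int CHAR('a::field)) = 1"
  obtains r :: "'a::field" where "of_nat i = r\<^sup>2" "r \<noteq> 0"
proof -
  have nz: "\<not> [int i = 0] (mod int CHAR('a))" and "QuadRes (int CHAR('a)) (int i)"
    using assms by (auto simp: Legendre_def split: if_splits)
  then obtain y where "[y\<^sup>2 = int i] (mod int CHAR('a))"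
    by (auto simp: QuadRes_def)
  then have y: "of_int (y\<^sup>2) = (of_int (int i) :: 'a)"
    by (subst of_int_eq_iff_cong_CHAR)
  have "(of_int (int i) :: 'a) \<noteq> of_int 0"
    using nz by (subst of_int_eq_iff_cong_CHAR)
  with y show thesis
    using that[of "of_int y"] by (cases "of_int y = (0 :: 'a)") auto
qed

text \<open>Squaring identifies 1 and -1, so it is not injective and by finiteness not surjective.
  Should the nonsquare found be \<open>c\<close>, multiplying it by the square of some
  \<open>t\<close> other than 0, 1, -1 gives another one.\<close>

lemma nonsquare_avoiding:
  fixes c :: "'a::{field, finite}"
  assumes "CARD('a) \<ge> 4" "(2 :: 'a) \<noteq> 0"
  obtains n where "n \<noteq> c" "\<And>r. n \<noteq> r\<^sup>2"
proof -
  have "\<not> inj (\<lambda>r :: 'a. r\<^sup>2)"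
  proof
    assume "inj (\<lambda>r :: 'a. r\<^sup>2)"
    then have "(1 :: 'a) = - 1"
      by (rule injD) simp
    then show False
      using assms(2) by (metis add.right_inverse one_add_one)
  qed
  then have "\<not> surj (\<lambda>r :: 'a. r\<^sup>2)"
    using finite_UNIV_surj_inj[of "\<lambda>r :: 'a. r\<^sup>2"] by auto
  then obtain n :: 'a where n: "\<And>r. n \<noteq> r\<^sup>2"
    by (metis surjI)
  have "\<exists>t :: 'a. t \<notin> {0, 1, -1}"
  proof (rule ccontr)
    assume "\<nexists>t :: 'a. t \<notin> {0, 1, -1}"
    then have "UNIV = {0 :: 'a, 1, -1}" by blast
    then show False
      using assms(1) card_length[of "[0 :: 'a, 1, -1]"] by simp
  qed
  then obtain t :: 'a where t: "t \<noteq> 0" "t \<noteq> 1" "t \<noteq> -1" by auto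
  show thesis
  proof (cases "n = c")
    case False
    then show ?thesis using n that by blast
  next
    case True
    have "n * t\<^sup>2 \<noteq> r\<^sup>2" for r
      using n[of "r / t"] t(1) by (simp add: power_divide field_simps)
    moreover have "n * t\<^sup>2 \<noteq> c"
      using n[of 0] t True by (auto simp: power2_eq_1_iff)
    ultimately show ?thesis using that by blast
  qed
qed

section \<open>A long sequence without zero subsequences\<close>

lemma quad_phi_two_values:
  "quad_phi lam mu (replicate_mset k x + replicate_mset j y) =
     (of_nat k * x + of_nat j * y)\<^sup>2 + of_nat k * (lam * x\<^sup>2 + mu * x) + of_nat j * (lam * y\<^sup>2 + mu * y)"
  by (simp add: quad_phi_def sum_mset_replicate_mset algebra_simps)

text \<open>Cutting \<open>T\<close> along the first block, instead of counting multiplicities, also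
  covers \<open>x = y\<close>.\<close>

lemma subseteq_two_values:
  assumes "T \<subseteq># replicate_mset m x + replicate_mset n y"
  obtains k j where "k \<le> m" "j \<le> n" "T = replicate_mset k x + replicate_mset j y"
proof -
  let ?X = "replicate_mset m x"
  have "T = T \<inter># ?X + (T - ?X)"
    by (simp add: multiset_eq_iff)
  moreover obtain k where "k \<le> m" "T \<inter># ?X = replicate_mset k x"
    by (metis msubseteq_replicate_msetE subset_mset.inf_le2)
  moreover have "T - ?X \<subseteq># replicate_mset n y"
    using assms by (simp add: subset_eq_diff_conv add.commute)
  then obtain j where "j \<le> n" "T - ?X = replicate_mset j y"
    by (metis msubseteq_replicate_msetE)
  ultimately show thesis
    using that by metis
qed

lemma zero_free_sequence:
  fixes lam mu :: "'a::{field, finite}"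
  assumes "prime CARD('a)" "CARD('a) \<ge> 5" "lam \<noteq> 0" "mu \<noteq> 0"
    and squares: "\<And>j. 0 < j \<Longrightarrow> j \<le> s \<Longrightarrow> \<exists>r :: 'a. r \<noteq> 0 \<and> of_nat j = r\<^sup>2"
  obtains S where "size S = CARD('a) - 1 + s"
    "\<And>T. T \<subseteq># S \<Longrightarrow> T \<noteq> {#} \<Longrightarrow> quad_phi lam mu T \<noteq> 0"
proof -
  have dvd: "of_nat k = (0 :: 'a) \<longleftrightarrow> CARD('a) dvd k" for k
    using CHAR_eq_prime_CARD[OF assms(1)] by (simp add: of_nat_eq_0_iff_char_dvd)
  have "(2 :: 'a) \<noteq> 0"
    using dvd[of 2] assms(2) by (auto dest: dvd_imp_le)
  \<comment> \<open>Avoiding \<open>- lam\<close> keeps the denominator of \<open>y\<close> below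
    nonzero.\<close>
  then obtain n where n: "n \<noteq> - lam" "\<And>r. n \<noteq> r\<^sup>2"
    using nonsquare_avoiding[of "- lam"] assms(2) by auto
  define x where "x = - mu / lam"
  \<comment> \<open>With \<open>y = 1/z\<close> the value \<open>-(\<lambda>y\<^sup>2 + \<mu>y)\<close> is \<open>-(\<lambda> + \<mu>z)/z\<^sup>2\<close>, so \<open>z\<close> solves \<open>-(\<lambda> + \<mu>z) = n\<close>.\<close>
  define y where "y = - mu / (n + lam)"
  have x: "x \<noteq> 0" "lam * x\<^sup>2 + mu * x = 0"
    using assms(3,4) by (auto simp: x_def field_simps power2_eq_square)
  have "n + lam \<noteq> 0"
    using n(1) by (simp add: eq_neg_iff_add_eq_0)
  then have y: "y \<noteq> 0" and mu: "mu = - ((n + lam) * y)"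
    using assms(4) by (simp_all add: y_def)
  have gy: "lam * y\<^sup>2 + mu * y = - n * y\<^sup>2"
    unfolding mu by (simp add: power2_eq_square algebra_simps)
  let ?S = "replicate_mset (CARD('a) - 1) x + replicate_mset s y"
  have "quad_phi lam mu T \<noteq> 0" if "T \<subseteq># ?S" and ne: "T \<noteq> {#}" for T
  proof -
    obtain k j where kj: "k \<le> CARD('a) - 1" "j \<le> s" "T = replicate_mset k x + replicate_mset j y"
      using subseteq_two_values[OF \<open>T \<subseteq># ?S\<close>] by metis
    define w where "w = of_nat k * x + of_nat j * y"
    have phi: "quad_phi lam mu T = w\<^sup>2 - of_nat j * (n * y\<^sup>2)"
      unfolding kj(3) quad_phi_two_values x(2) gy by (simp add: w_def)
    show ?thesis
    proof (cases "j = 0")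
      case True
      with ne kj(3) have "0 < k" by auto
      moreover have "k < CARD('a)"
        using kj(1) assms(2) by linarith
      ultimately have "of_nat k \<noteq> (0 :: 'a)"
        using dvd[of k] by (auto dest: dvd_imp_le)
      then show ?thesis
        using True x(1) phi by (simp add: w_def)
    next
      case False
      then obtain r :: 'a where r: "r \<noteq> 0" "of_nat j = r\<^sup>2"
        using squares kj(2) by blast
      \<comment> \<open>A zero value would mean
        \<open>w\<^sup>2 = r\<^sup>2 * n * y\<^sup>2\<close>, making \<open>n\<close> the square of
        \<open>w / (r * y)\<close>.\<close>
      show ?thesis
        using n(2)[of "w / (r * y)"] phi r y by (auto simp: power_divide power_mult_distrib field_simps)
    qed
  qed
  then show thesis
    using that[of ?S] by simp
qed

theorem theorem4p4:
  fixes p s :: nat and lam mu :: "'a::{field, finite}"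
  assumes "prime p" and "p \<ge> 5" and "CARD('a) = p"
    and "lam * mu \<noteq> 0"
    and "s > 0"
    and "\<forall>i\<in>{1..s}. Legendre (int i) (int p) = 1"
  shows "enat (2 * p - 1) \<ge> davenport (quad_phi lam mu) \<and>
         davenport (quad_phi lam mu) \<ge> enat (p + s)"
proof
  have "\<exists>T. T \<subseteq># S \<and> T \<noteq> {#} \<and> zero_sequence (quad_phi lam mu) T"
    if size: "2 * p - 1 \<le> size S" for S :: "'a multiset"
  proof -
    obtain T where "T \<subseteq># S" "T \<noteq> {#}" "(\<Sum>x\<in>#T. x) = 0" "(\<Sum>x\<in>#T. x\<^sup>2) = 0"
      by (rule two_zero_sums_mset[of S "\<lambda>x. x" "\<lambda>x. x\<^sup>2"]) (use size assms(3) in simp_all)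
    then show ?thesis
      by (auto simp: zero_sequence_def quad_phi_def)
  qed
  then show "davenport (quad_phi lam mu) \<le> enat (2 * p - 1)"
    unfolding davenport_def using assms(2) by (intro Inf_lower) auto
next
  have "CHAR('a) = p"
    using CHAR_eq_prime_CARD assms(1,3) by metis
  then have squares: "\<exists>r :: 'a. r \<noteq> 0 \<and> of_nat j = r\<^sup>2" if "0 < j" "j \<le> s" for j
    using of_nat_square_of_Legendre[of j] assms(6) that by (metis One_nat_def Suc_leI atLeastAtMost_iff)
  obtain S where S: "size S = p - 1 + s" "\<And>T. T \<subseteq># S \<Longrightarrow> T \<noteq> {#} \<Longrightarrow> quad_phi lam mu T \<noteq> 0"
    using zero_free_sequence[of lam mu s] squares assms(1-4) by auto
  show "enat (p + s) \<le> davenport (quad_phi lam mu)"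
    unfolding davenport_def
  \<comment> \<open>Every admissible length must exceed the size \<open>p - 1 + s\<close> of the
    zero-free \<open>S\<close>.\<close>
  proof (rule Inf_greatest, clarify)
    fix l
    assume l: "\<forall>S :: 'a multiset. l \<le> size S \<longrightarrow>
      (\<exists>T. T \<subseteq># S \<and> T \<noteq> {#} \<and> zero_sequence (quad_phi lam mu) T)"
    then have "\<not> l \<le> size S"
      using S(2) by (auto simp: zero_sequence_def)
    then show "enat (p + s) \<le> enat l"
      using S(1) by simp
  qed
qed

end
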